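(* For any $n\ge1$ and any pattern pair $$p\in\{(000,011),(011,012),(001,101),(001,102),(001,201),(010,012)\},$$ we have $|\mathbf{I}_n(p)|=2^{n-1}$.
   Context: An inversion sequence of length $n$ is an integer sequence $e=(e_1,\dots,e_n)$ with $0\le e_i\le i-1$ for all $1\le i\le n$. A word $w_1\cdots w_n$ avoids a pattern $P=p_1\cdots p_k$ if there are no $i_1<\cdots<i_k$ such that $w_{i_1}\cdots w_{i_k}$ is order isomorphic to $P$ (equal letters of $P$ corresponding to equal entries). For a pair $p=(P_1,P_2)$ of patterns, $\mathbf{I}_n(p)$ denotes the set of inversion sequences of length $n$ avoiding both $P_1$ and $P_2$. *)

theory Defs
  imports Main "HOL-Library.Sublist"
begin

text \<open>
  Lists are indexed from 0, so the entry \<open>e\<^sub>i\<close> with \<open>1 \<le> i \<le> n\<close> is \<open>e ! (i - 1)\<close>, and the bound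
  \<open>0 \<le> e\<^sub>i \<le> i - 1\<close> becomes \<open>e ! i \<le> i\<close> for \<open>i < n\<close>.
\<close>

definition inversion_sequence :: "nat list \<Rightarrow> bool" where
  "inversion_sequence e \<longleftrightarrow> (\<forall>i<length e. e ! i \<le> i)"

definition order_isomorphic :: "nat list \<Rightarrow> nat list \<Rightarrow> bool" where
  "order_isomorphic u v \<longleftrightarrow> length u = length v \<and>
     (\<forall>i<length u. \<forall>j<length u.
        (u ! i < u ! j \<longleftrightarrow> v ! i < v ! j) \<and> (u ! i = u ! j \<longleftrightarrow> v ! i = v ! j))"

text \<open>The subsequence need not consist of consecutive entries.\<close>

definition avoids :: "nat list \<Rightarrow> nat list \<Rightarrow> bool" where
  "avoids w P \<longleftrightarrow> \<not> (\<exists>u. subseq u w \<and> order_isomorphic u P)"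

definition avoiding_inversion_sequences :: "nat \<Rightarrow> nat list \<times> nat list \<Rightarrow> nat list set" where
  "avoiding_inversion_sequences n p =
     {e. length e = n \<and> inversion_sequence e \<and> avoids e (fst p) \<and> avoids e (snd p)}"

end

theory Submission
  imports Defs
begin

text \<open>
  For every pair the cardinality is 1 when \<open>n = 1\<close>, and it doubles from each length to the next,
  because every avoider of length \<open>n\<close> can be extended to length \<open>n + 1\<close> in exactly two ways, each
  longer avoider being reached once. What an extension does depends on the pair.

  \<^item> \<open>(000, 011)\<close>: all entries after the initial \<open>0\<close> are distinct, and conversely. A sequence of
    length \<open>n\<close> uses \<open>n - 1\<close> of the \<open>n + 1\<close> letters \<open>0, \<dots>, n\<close> after its initial \<open>0\<close>, which
    leaves two letters that may be appended (\<open>card_distinct_bounded_lists\<close>).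

  \<^item> \<open>(001, 101)\<close>, \<open>(001, 102)\<close>, \<open>(001, 201)\<close>: an inversion sequence that avoids the
    first pattern avoids the second (\<open>no_valley_if_avoids_001\<close>). A sequence avoiding 001 that ends in \<open>0\<close> is an arbitrary
    shorter avoider with \<open>0\<close> appended. If it does not end in \<open>0\<close>, its initial \<open>0\<close> is its only one,
    and removing that letter and lowering the others by 1 gives an arbitrary shorter avoider
    (\<open>avoiders_001_step\<close>).

  \<^item> \<open>(011, 012)\<close>, \<open>(010, 012)\<close>: the avoiders are split by whether the letter \<open>1\<close> occurs. If it does
    not, removing the initial \<open>0\<close> and lowering the letters greater than 1 gives an arbitrary shorter
    avoider (\<open>avoiders_without_1\<close>). If it does, the last letter is determined by the rest, and
    removing it gives an arbitrary shorter avoider (\<open>card_avoiders_Suc\<close>).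
\<close>

section \<open>Pattern avoidance\<close>

text \<open>
  Comparing two positions in one order determines the outcome in the other order, so three of the
  nine comparisons suffice.
\<close>

lemma order_isomorphic_triple:
  "order_isomorphic u [a, b, c] \<longleftrightarrow>
     (\<exists>x y z. u = [x, y, z] \<and> (x < y \<longleftrightarrow> a < b) \<and> (x = y \<longleftrightarrow> a = b) \<and>
        (x < z \<longleftrightarrow> a < c) \<and> (x = z \<longleftrightarrow> a = c) \<and> (y < z \<longleftrightarrow> b < c) \<and> (y = z \<longleftrightarrow> b = c))"
proof (cases "length u = 3")
  case True
  then obtain x y z where u: "u = [x, y, z]"
    by (auto simp: numeral_3_eq_3 length_Suc_conv)
  have converse: "(q < p \<longleftrightarrow> s < r) \<and> (q = p \<longleftrightarrow> s = r)"
    if "p < q \<longleftrightarrow> r < s" "p = q \<longleftrightarrow> r = s" for p q r s :: nat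
    using that by (cases "p < q"; cases "p = q") auto
  show ?thesis
  proof
    assume "order_isomorphic u [a, b, c]"
    then show "\<exists>x y z. u = [x, y, z] \<and> (x < y \<longleftrightarrow> a < b) \<and> (x = y \<longleftrightarrow> a = b) \<and>
        (x < z \<longleftrightarrow> a < c) \<and> (x = z \<longleftrightarrow> a = c) \<and> (y < z \<longleftrightarrow> b < c) \<and> (y = z \<longleftrightarrow> b = c)"
      by (simp add: u order_isomorphic_def All_less_Suc2)
  next
    assume "\<exists>x y z. u = [x, y, z] \<and> (x < y \<longleftrightarrow> a < b) \<and> (x = y \<longleftrightarrow> a = b) \<and>
        (x < z \<longleftrightarrow> a < c) \<and> (x = z \<longleftrightarrow> a = c) \<and> (y < z \<longleftrightarrow> b < c) \<and> (y = z \<longleftrightarrow> b = c)"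
    then show "order_isomorphic u [a, b, c]"
      using converse[of x y a b] converse[of x z a c] converse[of y z b c]
      by (simp add: u order_isomorphic_def All_less_Suc2)
  qed
next
  case False
  then show ?thesis
    by (auto simp: order_isomorphic_def)
qed

lemma avoids_triple:
  "avoids w [a, b, c] \<longleftrightarrow>
     (\<forall>x y z. subseq [x, y, z] w \<longrightarrow>
        \<not> ((x < y \<longleftrightarrow> a < b) \<and> (x = y \<longleftrightarrow> a = b) \<and> (x < z \<longleftrightarrow> a < c) \<and>
           (x = z \<longleftrightarrow> a = c) \<and> (y < z \<longleftrightarrow> b < c) \<and> (y = z \<longleftrightarrow> b = c)))"
  unfolding avoids_def order_isomorphic_triple by blast

lemma avoids_singleton: "length P > 1 \<Longrightarrow> avoids [x] P"
  by (auto simp: avoids_def order_isomorphic_def dest!: list_emb_length)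

lemma avoids_subseq: "avoids w P \<Longrightarrow> subseq v w \<Longrightarrow> avoids v P"
  unfolding avoids_def by (meson subseq_order.trans)

lemma subseq_map_iff: "subseq u (map f w) \<longleftrightarrow> (\<exists>v. subseq v w \<and> u = map f v)"
  by (auto simp: subseq_conv_nths nths_map)

lemma avoids_map_strict_mono:
  assumes "strict_mono f"
  shows "avoids (map f w) P \<longleftrightarrow> avoids w P"
proof -
  have iso: "order_isomorphic (map f v) P \<longleftrightarrow> order_isomorphic v P" for v
    using assms by (auto simp: order_isomorphic_def strict_mono_less strict_mono_eq)
  then show ?thesis
    unfolding avoids_def subseq_map_iff by auto
qed

text \<open>
  An occurrence of a pattern whose first two letters differ cannot use both copies of a doubled
  first letter, and the second copy can stand in for the first.
\<close>

lemma avoids_double_head: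
  assumes "a \<noteq> b"
  shows "avoids (x # x # w) (a # b # P) \<longleftrightarrow> avoids (x # w) (a # b # P)"
proof
  assume "avoids (x # x # w) (a # b # P)"
  then show "avoids (x # w) (a # b # P)"
    by (rule avoids_subseq) auto
next
  assume avoid: "avoids (x # w) (a # b # P)"
  have False if "subseq u (x # x # w)" and iso: "order_isomorphic u (a # b # P)" for u
  proof -
    obtain u0 u1 us where u: "u = u0 # u1 # us"
      using iso by (cases u; cases "tl u") (auto simp: order_isomorphic_def)
    have "\<forall>i<length u. \<forall>j<length u. u ! i = u ! j \<longleftrightarrow> (a # b # P) ! i = (a # b # P) ! j"
      using iso unfolding order_isomorphic_def by blast
    from this[rule_format, of 0 1] have "u0 = u1 \<longleftrightarrow> a = b"
      by (simp add: u)
    then have "subseq u (x # w)"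
      using that(1) assms by (auto simp: u split: if_splits)
    then show False
      using avoid iso by (auto simp: avoids_def)
  qed
  then show "avoids (x # x # w) (a # b # P)"
    by (auto simp: avoids_def)
qed

lemma subseq_snoc_iff:
  "subseq (u @ [z]) (w @ [c]) \<longleftrightarrow> subseq (u @ [z]) w \<or> z = c \<and> subseq u w"
proof
  assume "subseq (u @ [z]) (w @ [c])"
  then obtain u1 u2 where eq: "u @ [z] = u1 @ u2" and u1: "subseq u1 w" and u2: "subseq u2 [c]"
    by (rule subseq_appendE)
  show "subseq (u @ [z]) w \<or> z = c \<and> subseq u w"
  proof (cases u2 rule: rev_cases)
    case Nil
    then show ?thesis using eq u1 by simp
  next
    case (snoc u2' y)
    then have "u2 = [c]"
      using u2 list_emb_length[OF u2] by (cases u2') (auto split: if_splits)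
    then show ?thesis using eq u1 by simp
  qed
qed (auto intro: subseq_rev_drop_many)

lemma subseq_triple_snoc:
  "subseq [x, y, z] (w @ [c]) \<longleftrightarrow> subseq [x, y, z] w \<or> z = c \<and> subseq [x, y] w"
  using subseq_snoc_iff[of "[x, y]"] by simp

lemma avoids_triple_snoc:
  "avoids (w @ [z]) [a, b, c] \<longleftrightarrow>
     avoids w [a, b, c] \<and>
     (\<forall>x y. subseq [x, y] w \<longrightarrow>
        \<not> ((x < y \<longleftrightarrow> a < b) \<and> (x = y \<longleftrightarrow> a = b) \<and> (x < z \<longleftrightarrow> a < c) \<and>
           (x = z \<longleftrightarrow> a = c) \<and> (y < z \<longleftrightarrow> b < c) \<and> (y = z \<longleftrightarrow> b = c)))"
  unfolding avoids_triple subseq_triple_snoc by blast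

section \<open>Inversion sequences\<close>

lemma inversion_sequence_Cons:
  "inversion_sequence (x # t) \<longleftrightarrow> x = 0 \<and> (\<forall>i<length t. t ! i \<le> Suc i)"
  by (auto simp: inversion_sequence_def nth_Cons less_Suc_eq_0_disj split: nat.splits)

lemma inversion_sequence_snoc:
  "inversion_sequence (e @ [x]) \<longleftrightarrow> inversion_sequence e \<and> x \<le> length e"
  by (auto simp: inversion_sequence_def nth_append less_Suc_eq)

lemma finite_avoiding_inversion_sequences: "finite (avoiding_inversion_sequences n p)"
proof (rule finite_subset)
  show "avoiding_inversion_sequences n p \<subseteq> {e. set e \<subseteq> {..n} \<and> length e = n}"
    by (force simp: avoiding_inversion_sequences_def inversion_sequence_def in_set_conv_nth)
qed (rule finite_lists_length_eq, simp)

lemma avoiding_inversion_sequences_1: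
  assumes "length P > 1" and "length Q > 1"
  shows "avoiding_inversion_sequences 1 (P, Q) = {[0]}"
  using assms
  by (auto simp: avoiding_inversion_sequences_def inversion_sequence_Cons length_Suc_conv
      avoids_singleton)

lemma card_eq_power_if_doubling:
  fixes A :: "nat \<Rightarrow> 'a set"
  assumes "card (A 1) = 1" and "\<And>n. n \<ge> 1 \<Longrightarrow> card (A (Suc n)) = 2 * card (A n)" and "n \<ge> 1"
  shows "card (A n) = 2 ^ (n - 1)"
  using \<open>n \<ge> 1\<close>
proof (induction n rule: nat_induct_at_least)
  case (Suc n)
  then show ?case using assms(2) by (cases n) auto
qed (use assms(1) in simp)

section \<open>The pair (000, 011)\<close>

text \<open>
  The letters already used all satisfy the weaker bound on the next one, so the number of choices
  is always the same: \<open>m + 2\<close> letters are within the bound, and \<open>m\<close> of them are used.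
\<close>

lemma card_distinct_bounded_lists:
  "card {t. length t = m \<and> distinct t \<and> (\<forall>i<length t. t ! i \<le> Suc i)} = 2 ^ m"
proof (induction m)
  case 0
  have "{t. length t = 0 \<and> distinct t \<and> (\<forall>i<length t. t ! i \<le> Suc i)} = {[] :: nat list}"
    by auto
  then show ?case by simp
next
  case (Suc m)
  define T where "T m = {t. length t = m \<and> distinct t \<and> (\<forall>i<length t. t ! i \<le> Suc i)}" for m
  let ?free = "\<lambda>t. {..Suc m} - set t"
  have card_T: "card (T m) = 2 ^ m"
    using Suc.IH by (simp add: T_def)
  then have "finite (T m)"
    by (intro card_ge_0_finite) simp
  have card_free: "card (?free t) = 2" if "t \<in> T m" for t
  proof -
    have "set t \<subseteq> {..Suc m}" "card (set t) = m"
      using that by (force simp: T_def in_set_conv_nth distinct_card)+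
    then show ?thesis
      by (simp add: card_Diff_subset)
  qed
  have "T (Suc m) = (\<lambda>(t, x). t @ [x]) ` Sigma (T m) ?free"
  proof (intro equalityI subsetI)
    fix s assume s: "s \<in> T (Suc m)"
    then obtain t x where "s = t @ [x]"
      by (cases s rule: rev_cases) (auto simp: T_def)
    with s show "s \<in> (\<lambda>(t, x). t @ [x]) ` Sigma (T m) ?free"
      by (force simp: T_def nth_append less_Suc_eq all_conj_distrib)
  qed (auto simp: T_def nth_append less_Suc_eq)
  moreover have "inj_on (\<lambda>(t, x). t @ [x]) (Sigma (T m) ?free)"
    by (auto simp: inj_on_def)
  ultimately have "card (T (Suc m)) = card (Sigma (T m) ?free)"
    by (simp add: card_image)
  also have "\<dots> = (\<Sum>t\<in>T m. card (?free t))"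
    using \<open>finite (T m)\<close> by simp
  also have "\<dots> = 2 ^ Suc m"
    by (simp add: card_free card_T)
  finally show ?case by (simp add: T_def)
qed

lemma distinct_iff_no_pair: "distinct t \<longleftrightarrow> (\<forall>x. \<not> subseq [x, x] t)"
proof (induction t)
  case (Cons a t)
  have "a \<in> set t" if "subseq [a, a] t"
    using list_emb_set[OF that] by auto
  then show ?case
    using Cons.IH by (auto simp: subseq_singleton_left)
qed simp

text \<open>
  A letter repeated after the initial \<open>0\<close> gives 000 if it is \<open>0\<close> and 011 otherwise. Conversely, both
  patterns end in a repeated letter, which lies after the initial \<open>0\<close>.
\<close>

lemma avoids_000_011_iff_distinct:
  "avoids (0 # t) [0,0,0] \<and> avoids (0 # t) [0,1,1] \<longleftrightarrow> distinct t"
proof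
  assume avoid: "avoids (0 # t) [0,0,0] \<and> avoids (0 # t) [0,1,1]"
  have "\<not> subseq [x, x] t" for x
  proof
    assume "subseq [x, x] t"
    then have "subseq [0, x, x] (0 # t)" by simp
    moreover have "order_isomorphic [0, x, x] [0,0,0] \<or> order_isomorphic [0, x, x] [0,1,1]"
      by (auto simp: order_isomorphic_triple)
    ultimately show False
      using avoid by (auto simp only: avoids_def)
  qed
  then show "distinct t"
    by (simp add: distinct_iff_no_pair)
next
  assume "distinct t"
  then have "\<not> subseq [y, y] t" for y
    by (simp add: distinct_iff_no_pair)
  then have "\<not> subseq [x, y, y] (0 # t)" for x y
    using subseq_Cons'[of x "[y, y]" t] by auto
  then show "avoids (0 # t) [0,0,0] \<and> avoids (0 # t) [0,1,1]"
    by (auto simp: avoids_triple simp del: subseq_Cons2_iff)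
qed

lemma card_avoiders_000_011:
  assumes "n \<ge> 1"
  shows "card (avoiding_inversion_sequences n ([0,0,0], [0,1,1])) = 2 ^ (n - 1)"
proof -
  let ?T = "{t. length t = n - 1 \<and> distinct t \<and> (\<forall>i<length t. t ! i \<le> Suc i)}"
  have "avoiding_inversion_sequences n ([0,0,0], [0,1,1]) = (#) 0 ` ?T"
  proof (intro equalityI subsetI)
    fix e assume e: "e \<in> avoiding_inversion_sequences n ([0,0,0], [0,1,1])"
    then obtain x t where "e = x # t"
      using assms by (cases e) (auto simp: avoiding_inversion_sequences_def)
    then show "e \<in> (#) 0 ` ?T"
      using e avoids_000_011_iff_distinct[of t]
      by (auto simp: avoiding_inversion_sequences_def inversion_sequence_Cons)
  next
    fix e assume "e \<in> (#) 0 ` ?T"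
    then show "e \<in> avoiding_inversion_sequences n ([0,0,0], [0,1,1])"
      using assms avoids_000_011_iff_distinct
      by (auto simp: avoiding_inversion_sequences_def inversion_sequence_Cons)
  qed
  then show ?thesis
    by (simp add: card_image card_distinct_bounded_lists)
qed

section \<open>The pairs containing 001\<close>

text \<open>
  After two letters \<open>0\<close>, the pattern 001 excludes every positive letter. So the letter \<open>0\<close> occurs only
  at the beginning, or it is also the last letter. The pattern is listed twice in the pair because
  it is the only one to be avoided here.
\<close>

lemma avoiders_001_step:
  fixes n :: nat
  defines "A \<equiv> (\<lambda>n. avoiding_inversion_sequences n ([0,0,1], [0,0,1]))"
  assumes "n \<ge> 1"
  shows "A (Suc n) = (\<lambda>e. e @ [0]) ` A n \<union> (\<lambda>e. 0 # map Suc e) ` A n"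
proof (intro equalityI subsetI)
  fix e assume "e \<in> A (Suc n)"
  then have len: "length e = Suc n" and inv: "inversion_sequence e" and avoid: "avoids e [0,0,1]"
    by (auto simp: A_def avoiding_inversion_sequences_def)
  obtain e' x where e': "e = e' @ [x]"
    using len by (cases e rule: rev_cases) auto
  obtain t where t: "e = 0 # t"
    using inv len by (cases e) (auto simp: inversion_sequence_Cons)
  show "e \<in> (\<lambda>e. e @ [0]) ` A n \<union> (\<lambda>e. 0 # map Suc e) ` A n"
  proof (cases "x = 0")
    case True
    have "avoids e' [0,0,1]"
      using avoid by (rule avoids_subseq) (simp add: e' subseq_rev_drop_many)
    then show ?thesis
      using True inv len e'
      by (auto simp: A_def avoiding_inversion_sequences_def inversion_sequence_snoc)
  next
    case False
    have "0 \<notin> set t"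
    proof
      assume "0 \<in> set t"
      obtain t' where t': "e' = 0 # t'" "t = t' @ [x]"
        using e' t assms(2) len by (cases e') auto
      then have "subseq [0, 0, x] e"
        using \<open>0 \<in> set t\<close> False subseq_snoc_iff[of "[0]" x t' x]
        by (auto simp: e' subseq_singleton_left)
      then show False
        using avoid False by (auto simp: avoids_triple)
    qed
    then have "map Suc (map (\<lambda>x. x - 1) t) = t"
      by (induction t) auto
    then obtain s where s: "t = map Suc s" by metis
    have "avoids (map Suc s) [0,0,1]"
      using avoid by (rule avoids_subseq) (auto simp: t s)
    then have "avoids s [0,0,1]"
      by (simp add: avoids_map_strict_mono strict_mono_Suc_iff)
    then show ?thesis
      using inv len
      by (auto simp: A_def avoiding_inversion_sequences_def t s inversion_sequence_Cons)
         (auto simp: inversion_sequence_def)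
  qed
next
  fix e assume "e \<in> (\<lambda>e. e @ [0]) ` A n \<union> (\<lambda>e. 0 # map Suc e) ` A n"
  then obtain d where d: "d \<in> A n" "e = d @ [0] \<or> e = 0 # map Suc d"
    by auto
  have len: "length d = n" and inv: "inversion_sequence d" and avoid: "avoids d [0,0,1]"
    using d(1) by (auto simp: A_def avoiding_inversion_sequences_def)
  from d(2) show "e \<in> A (Suc n)"
  proof
    assume e: "e = d @ [0]"
    then have "avoids e [0,0,1]"
      using avoid by (auto simp: avoids_triple_snoc)
    then show ?thesis
      using inv len e
      by (auto simp: A_def avoiding_inversion_sequences_def inversion_sequence_snoc)
  next
    assume e: "e = 0 # map Suc d"
    have "avoids (map Suc d) [0,0,1]"
      using avoid by (simp add: avoids_map_strict_mono strict_mono_Suc_iff)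
    moreover have "\<not> subseq [0, y] (map Suc d)" for y
    proof
      assume "subseq [0, y] (map Suc d)"
      from list_emb_set[OF this, of 0] show False by auto
    qed
    ultimately have "avoids e [0,0,1]"
      by (auto simp: avoids_triple e split: if_splits intro!: gr0I)
    then show ?thesis
      using inv len e
      by (auto simp: A_def avoiding_inversion_sequences_def inversion_sequence_Cons)
         (auto simp: inversion_sequence_def)
  qed
qed

lemma card_avoiders_001:
  assumes "n \<ge> 1"
  shows "card (avoiding_inversion_sequences n ([0,0,1], [0,0,1])) = 2 ^ (n - 1)"
proof (rule card_eq_power_if_doubling[OF _ _ assms])
  let ?A = "\<lambda>n. avoiding_inversion_sequences n ([0,0,1], [0,0,1])"
  show "card (?A 1) = 1"
    using avoiding_inversion_sequences_1 by simp
  fix n :: nat assume "n \<ge> 1"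
  have "(\<lambda>e. e @ [0]) ` ?A n \<inter> (\<lambda>e. 0 # map Suc e) ` ?A n = {}"
  proof -
    have "d @ [0] \<noteq> 0 # map Suc e" if "length e = n" for d e
    proof
      assume "d @ [0] = 0 # map Suc e"
      then have "last (d @ [0]) = last (0 # map Suc e)" by simp
      then show False
        using that \<open>n \<ge> 1\<close> by (auto simp: last_map split: if_splits)
    qed
    then show ?thesis
      by (auto simp: avoiding_inversion_sequences_def)
  qed
  moreover have "inj_on (\<lambda>e. e @ [0]) (?A n)" "inj_on (\<lambda>e. 0 # map Suc e) (?A n)"
    by (auto simp: inj_on_def)
  ultimately show "card (?A (Suc n)) = 2 * card (?A n)"
    using avoiders_001_step[OF \<open>n \<ge> 1\<close>]
    by (simp add: card_Un_disjoint card_image finite_avoiding_inversion_sequences)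
qed

text \<open>
  Neither way of extending an avoider of 001 creates a triple whose middle letter is strictly
  smallest: an appended \<open>0\<close> cannot be the right letter, and a prepended \<open>0\<close> cannot be the left one.
\<close>

lemma no_valley_if_avoids_001:
  assumes "inversion_sequence e" and "avoids e [0,0,1]" and "y < x" and "y < z"
  shows "\<not> subseq [x, y, z] e"
proof (cases "length e \<ge> 1")
  case True
  define n where "n = length e"
  have "n \<ge> 1" and "e \<in> avoiding_inversion_sequences n ([0,0,1], [0,0,1])"
    using True assms by (auto simp: n_def avoiding_inversion_sequences_def)
  then show ?thesis
    using assms(3,4)
  proof (induction n arbitrary: e x y z rule: nat_induct_at_least)
    case base
    then have "length e = 1" by (simp add: avoiding_inversion_sequences_def)
    then show ?case by simp
  next
    case (Suc n)
    then consider (snoc) d where "d \<in> avoiding_inversion_sequences n ([0,0,1], [0,0,1])" "e = d @ [0]"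
      | (shift) d where "d \<in> avoiding_inversion_sequences n ([0,0,1], [0,0,1])" "e = 0 # map Suc d"
      using avoiders_001_step by auto
    then show ?case
    proof cases
      case snoc
      then show ?thesis
        using Suc.IH[OF snoc(1)] Suc.prems by (auto simp: subseq_triple_snoc)
    next
      case shift
      show ?thesis
      proof
        assume "subseq [x, y, z] e"
        then have "subseq [x, y, z] (map Suc d)"
          using Suc.prems shift(2) by (auto split: if_splits)
        then obtain v where v: "subseq v d" "[x, y, z] = map Suc v"
          by (auto simp: subseq_map_iff)
        then obtain x' y' z' where "v = [x', y', z']" "x = Suc x'" "y = Suc y'" "z = Suc z'"
          by (auto simp: Cons_eq_map_conv)
        then show False
          using Suc.IH[OF shift(1)] Suc.prems v(1) by auto
      qed
    qed
  qed
qed (cases e; simp)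

lemma card_avoiders_001_valley:
  assumes "n \<ge> 1" and "b < a" and "b < c"
  shows "card (avoiding_inversion_sequences n ([0,0,1], [a, b, c])) = 2 ^ (n - 1)"
proof -
  have "avoids e [a, b, c]" if "inversion_sequence e" "avoids e [0,0,1]" for e
    unfolding avoids_triple
    using no_valley_if_avoids_001[OF that] assms(2,3) by (metis linorder_neqE_nat not_less_iff_gr_or_eq)
  then have "avoiding_inversion_sequences n ([0,0,1], [a, b, c]) =
      avoiding_inversion_sequences n ([0,0,1], [0,0,1])"
    by (auto simp: avoiding_inversion_sequences_def)
  then show ?thesis
    using card_avoiders_001[OF assms(1)] by simp
qed

section \<open>The pairs (011, 012) and (010, 012)\<close>

text \<open>The increasing bijection from the natural numbers to those other than 1.\<close>

definition skip_1 :: "nat \<Rightarrow> nat" where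
  "skip_1 x = (if x = 0 then 0 else Suc x)"

lemma strict_mono_skip_1: "strict_mono skip_1"
  by (auto simp: strict_mono_def skip_1_def)

lemma skip_1_le_Suc_iff: "skip_1 x \<le> Suc i \<longleftrightarrow> x \<le> i"
  by (auto simp: skip_1_def)

lemma skip_1_pred: "x \<noteq> 1 \<Longrightarrow> skip_1 (x - 1) = x"
  by (auto simp: skip_1_def)

text \<open>
  An inversion sequence without the letter \<open>1\<close> and of length at least 2 begins with \<open>0, 0\<close>. Dropping
  the first \<open>0\<close> does not affect avoidance because the first two letters of each pattern differ, and
  the gap at \<open>1\<close> is exactly the room that the bound on the entries loses by the drop.
\<close>

lemma avoiders_without_1:
  fixes P Q :: "nat list"
  assumes "n \<ge> 1" and "a \<noteq> b" and "c \<noteq> d"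
  defines "A \<equiv> (\<lambda>n. avoiding_inversion_sequences n (a # b # P, c # d # Q))"
  shows "{e \<in> A (Suc n). 1 \<notin> set e} = (\<lambda>e. 0 # map skip_1 e) ` A n"
proof -
  have iff: "0 # map skip_1 e \<in> A (Suc n) \<longleftrightarrow> e \<in> A n" if "e = 0 # t" for e t
  proof -
    have "avoids (0 # map skip_1 e) (a # b # P) \<longleftrightarrow> avoids e (a # b # P)" if "a \<noteq> b" for a b P
    proof -
      have "avoids (0 # map skip_1 e) (a # b # P) \<longleftrightarrow> avoids (map skip_1 e) (a # b # P)"
        using avoids_double_head[OF that] by (simp add: \<open>e = 0 # t\<close> skip_1_def)
      then show ?thesis
        by (simp add: avoids_map_strict_mono strict_mono_skip_1)
    qed
    moreover have "inversion_sequence (0 # map skip_1 e) \<longleftrightarrow> inversion_sequence e"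
      by (simp add: inversion_sequence_Cons) (simp add: inversion_sequence_def skip_1_le_Suc_iff)
    ultimately show ?thesis
      using assms(2,3) by (simp add: A_def avoiding_inversion_sequences_def)
  qed
  have shape: "\<exists>t. e = 0 # t" if "e \<in> A m" "m \<ge> 1" for e m
    using that by (cases e) (auto simp: A_def avoiding_inversion_sequences_def inversion_sequence_Cons)
  show ?thesis
  proof (intro equalityI subsetI)
    fix e assume e: "e \<in> {e \<in> A (Suc n). 1 \<notin> set e}"
    then obtain t where t: "e = 0 # t"
      using shape[of e "Suc n"] by auto
    define s where "s = map (\<lambda>x. x - 1) t"
    have "skip_1 (x - 1) = x" if "x \<in> set t" for x
      using e that skip_1_pred[of x] by (auto simp: t)
    then have "map skip_1 s = t"
      by (simp add: s_def map_idI)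
    obtain r where r: "s = 0 # r"
      using e assms(1) by (cases t) (auto simp: s_def t A_def avoiding_inversion_sequences_def
          inversion_sequence_Cons)
    show "e \<in> (\<lambda>e. 0 # map skip_1 e) ` A n"
      using iff[OF r] e \<open>map skip_1 s = t\<close> t by auto
  next
    fix e assume "e \<in> (\<lambda>e. 0 # map skip_1 e) ` A n"
    then obtain d where d: "d \<in> A n" "e = 0 # map skip_1 d" by auto
    then have "e \<in> A (Suc n)"
      using iff shape[OF d(1) assms(1)] by auto
    moreover have "1 \<notin> set e"
      by (auto simp: d(2) skip_1_def)
    ultimately show "e \<in> {e \<in> A (Suc n). 1 \<notin> set e}" by simp
  qed
qed

text \<open>
  The longer avoiders without the letter \<open>1\<close> are as many as the shorter avoiders. So are those with
  a \<open>1\<close>, provided that each shorter avoider \<open>e\<close> has exactly one admissible last letter \<open>c e\<close> that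
  produces a sequence containing \<open>1\<close>.
\<close>

lemma card_avoiders_Suc:
  fixes c :: "nat list \<Rightarrow> nat" and P Q :: "nat list"
  assumes "n \<ge> 1" and "a \<noteq> b" and "a' \<noteq> b'"
  defines "A \<equiv> (\<lambda>n. avoiding_inversion_sequences n (a # b # P, a' # b' # Q))"
  assumes append: "\<And>e. e \<in> A n \<Longrightarrow> e @ [c e] \<in> A (Suc n) \<and> 1 \<in> set (e @ [c e])"
    and unique: "\<And>e x. e @ [x] \<in> A (Suc n) \<Longrightarrow> 1 \<in> set (e @ [x]) \<Longrightarrow> x = c e"
  shows "card (A (Suc n)) = 2 * card (A n)"
proof -
  have fin: "finite (A m)" for m
    by (simp add: A_def finite_avoiding_inversion_sequences)
  have "{e \<in> A (Suc n). 1 \<in> set e} = (\<lambda>e. e @ [c e]) ` A n"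
  proof (intro equalityI subsetI)
    fix e assume e: "e \<in> {e \<in> A (Suc n). 1 \<in> set e}"
    then obtain d x where d: "e = d @ [x]"
      by (cases e rule: rev_cases) (auto simp: A_def avoiding_inversion_sequences_def)
    have "d \<in> A n"
      using e by (auto simp: A_def d avoiding_inversion_sequences_def inversion_sequence_snoc
          intro: avoids_subseq subseq_rev_drop_many)
    then show "e \<in> (\<lambda>e. e @ [c e]) ` A n"
      using unique e d by blast
  qed (use append in auto)
  moreover have "{e \<in> A (Suc n). 1 \<notin> set e} = (\<lambda>e. 0 # map skip_1 e) ` A n"
    using avoiders_without_1[OF assms(1-3)] by (simp add: A_def)
  moreover have "inj_on (\<lambda>e. e @ [c e]) (A n)"
    by (auto simp: inj_on_def)
  moreover have "inj_on (\<lambda>e. 0 # map skip_1 e) (A n)"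
    by (simp add: inj_on_def inj_map_eq_map[OF strict_mono_imp_inj_on[OF strict_mono_skip_1]])
  moreover have "card ({e \<in> A (Suc n). 1 \<in> set e} \<union> {e \<in> A (Suc n). 1 \<notin> set e}) =
      card {e \<in> A (Suc n). 1 \<in> set e} + card {e \<in> A (Suc n). 1 \<notin> set e}"
    by (intro card_Un_disjoint) (use fin in auto)
  moreover have "{e \<in> A (Suc n). 1 \<in> set e} \<union> {e \<in> A (Suc n). 1 \<notin> set e} = A (Suc n)"
    by auto
  ultimately show ?thesis
    by (simp add: card_image)
qed

lemma subseq_0_1:
  assumes "inversion_sequence e" and "1 \<in> set e"
  shows "subseq [0, 1] e"
  using assms by (cases e) (auto simp: inversion_sequence_Cons subseq_singleton_left)

text \<open>
  Once \<open>0, 1\<close> has occurred, 011 and 012 exclude every letter but \<open>0\<close>, and an appended \<open>0\<close> is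
  harmless because both patterns end in a letter greater than their first. Before that, \<open>1\<close> is the
  only letter that produces a \<open>1\<close>; it is harmless because no pair \<open>x < y\<close> with \<open>y \<le> 1\<close> precedes it.
\<close>

lemma card_avoiders_011_012:
  assumes "n \<ge> 1"
  shows "card (avoiding_inversion_sequences n ([0,1,1], [0,1,2])) = 2 ^ (n - 1)"
proof (rule card_eq_power_if_doubling[OF _ _ assms])
  let ?A = "\<lambda>n. avoiding_inversion_sequences n ([0,1,1], [0,1,2])"
  let ?c = "\<lambda>e. if 1 \<in> set e then 0 else 1 :: nat"
  show "card (?A 1) = 1"
    using avoiding_inversion_sequences_1 by simp
  fix n :: nat assume "n \<ge> 1"
  show "card (?A (Suc n)) = 2 * card (?A n)"
  proof (rule card_avoiders_Suc[OF \<open>n \<ge> 1\<close>, where c = ?c])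
    fix e assume e: "e \<in> ?A n"
    define c where "c = ?c e"
    have "\<not> (x < y \<and> y \<le> c)" if "subseq [x, y] e" for x y
      using list_emb_set[OF that] by (auto simp: c_def le_Suc_eq)
    then have "avoids (e @ [c]) [0,1,1]" "avoids (e @ [c]) [0,1,2]"
      using e by (fastforce simp: avoids_triple_snoc avoiding_inversion_sequences_def)+
    then show "e @ [?c e] \<in> ?A (Suc n) \<and> 1 \<in> set (e @ [?c e])"
      using e \<open>n \<ge> 1\<close> unfolding c_def
      by (auto simp: avoiding_inversion_sequences_def inversion_sequence_snoc)
  next
    fix e x assume ex: "e @ [x] \<in> ?A (Suc n)" "1 \<in> set (e @ [x])"
    have "x = 0" if "1 \<in> set e"
    proof (rule ccontr)
      assume "x \<noteq> 0"
      have "subseq [0, 1, x] (e @ [x])"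
        using subseq_0_1 ex that
        by (auto simp: avoiding_inversion_sequences_def inversion_sequence_snoc subseq_triple_snoc)
      moreover have "order_isomorphic [0, 1, x] [0,1,1] \<or> order_isomorphic [0, 1, x] [0,1,2]"
        using \<open>x \<noteq> 0\<close> by (auto simp: order_isomorphic_triple)
      ultimately show False
        using ex(1) unfolding avoiding_inversion_sequences_def avoids_def mem_Collect_eq fst_conv snd_conv
        by blast
    qed
    then show "x = ?c e" using ex by auto
  qed simp_all
qed

text \<open>
  Once \<open>0, 1\<close> has occurred, 010 and 012 exclude every letter but \<open>1\<close>. Appending \<open>1\<close> could only
  complete an occurrence \<open>1, y, 1\<close> of 010, but then \<open>0, 1, y\<close> is an earlier occurrence of 012.
\<close>

lemma card_avoiders_010_012:
  assumes "n \<ge> 1"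
  shows "card (avoiding_inversion_sequences n ([0,1,0], [0,1,2])) = 2 ^ (n - 1)"
proof (rule card_eq_power_if_doubling[OF _ _ assms])
  let ?A = "\<lambda>n. avoiding_inversion_sequences n ([0,1,0], [0,1,2])"
  show "card (?A 1) = 1"
    using avoiding_inversion_sequences_1 by simp
  fix n :: nat assume "n \<ge> 1"
  show "card (?A (Suc n)) = 2 * card (?A n)"
  proof (rule card_avoiders_Suc[OF \<open>n \<ge> 1\<close>, where c = "\<lambda>_. 1"])
    fix e assume e: "e \<in> ?A n"
    have "\<not> (1 < y)" if "subseq [1, y] e" for y
    proof
      assume "1 < y"
      have "subseq [0, 1, y] e"
        using e that \<open>n \<ge> 1\<close>
        by (cases e) (auto simp: avoiding_inversion_sequences_def inversion_sequence_Cons)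
      moreover have "order_isomorphic [0, 1, y] [0,1,2]"
        using \<open>1 < y\<close> by (simp add: order_isomorphic_triple)
      moreover have "avoids e [0,1,2]"
        using e by (simp add: avoiding_inversion_sequences_def)
      ultimately show False
        unfolding avoids_def by blast
    qed
    then have "avoids (e @ [1]) [0,1,0]" "avoids (e @ [1]) [0,1,2]"
      using e by (auto simp: avoids_triple_snoc avoiding_inversion_sequences_def)
    then show "e @ [1] \<in> ?A (Suc n) \<and> 1 \<in> set (e @ [1])"
      using e \<open>n \<ge> 1\<close>
      by (auto simp: avoiding_inversion_sequences_def inversion_sequence_snoc)
  next
    fix e x assume ex: "e @ [x] \<in> ?A (Suc n)" "1 \<in> set (e @ [x])"
    show "x = 1"
    proof (rule ccontr)
      assume "x \<noteq> 1"
      have "subseq [0, 1, x] (e @ [x])"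
        using subseq_0_1 ex \<open>x \<noteq> 1\<close>
        by (auto simp: avoiding_inversion_sequences_def inversion_sequence_snoc subseq_triple_snoc)
      moreover have "order_isomorphic [0, 1, x] [0,1,0] \<or> order_isomorphic [0, 1, x] [0,1,2]"
        using \<open>x \<noteq> 1\<close> by (auto simp: order_isomorphic_triple)
      ultimately show False
        using ex(1) unfolding avoiding_inversion_sequences_def avoids_def mem_Collect_eq fst_conv snd_conv
        by blast
    qed
  qed simp_all
qed

section \<open>The common cardinality\<close>

theorem theorem2p13:
  fixes n :: nat and p :: "nat list \<times> nat list"
  assumes "n \<ge> 1"
    and "p \<in> {([0,0,0],[0,1,1]), ([0,1,1],[0,1,2]), ([0,0,1],[1,0,1]),
              ([0,0,1],[1,0,2]), ([0,0,1],[2,0,1]), ([0,1,0],[0,1,2])}"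
  shows "card (avoiding_inversion_sequences n p) = 2 ^ (n - 1)"
  using assms(2) card_avoiders_000_011[OF assms(1)] card_avoiders_001_valley[OF assms(1)]
    card_avoiders_011_012[OF assms(1)] card_avoiders_010_012[OF assms(1)]
  by auto

end
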